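(* Let $G$ be a connected unicyclic graph (a connected graph with exactly one cycle) of order $n\geq 3$ and maximum degree $\Delta(G)$, and let $k$ be an integer with $3\leq k\leq n$. If $G$ satisfies all of the following: (i) $G$ has at most two vertices of degree $\Delta(G)$; (ii) every vertex of degree $\Delta(G)$ lies on the unique cycle of $G$; (iii) if there are two vertices of degree $\Delta(G)$, they are adjacent in $G$; then $px_k(G)=\Delta(G)-1$. Otherwise, $px_k(G)=\Delta(G)$.
   Context: All graphs are finite, simple, undirected and connected. An edge-coloring of a graph assigns a color to each edge (adjacent edges may receive the same color). A tree in an edge-colored graph is proper if any two adjacent edges of the tree receive different colors. For $S\subseteq V(G)$, an $S$-tree is a subgraph of $G$ that is a tree containing all vertices of $S$. For a connected graph $G$ of order $n$ and an integer $k$ with $2\le k\le n$, an edge-coloring of $G$ is a $k$-proper coloring if for every set $S$ of $k$ vertices of $G$ there exists a proper $S$-tree in $G$. The $k$-proper index $px_k(G)$ is the minimum number of colors used in a $k$-proper coloring of $G$. *)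

theory Defs
  imports Main
begin

text \<open>Simple graphs: a vertex set V and an edge set E of 2-element subsets of V.\<close>

definition simple_graph :: "'a set \<Rightarrow> 'a set set \<Rightarrow> bool" where
  "simple_graph V E \<longleftrightarrow> finite V \<and> (\<forall>e\<in>E. \<exists>u v. u \<in> V \<and> v \<in> V \<and> u \<noteq> v \<and> e = {u, v})"

definition adj_rel :: "'a set set \<Rightarrow> ('a \<times> 'a) set" where
  "adj_rel E = {(u, v). {u, v} \<in> E}"

definition connected_graph :: "'a set \<Rightarrow> 'a set set \<Rightarrow> bool" where
  "connected_graph V E \<longleftrightarrow> V \<noteq> {} \<and> (\<forall>u\<in>V. \<forall>v\<in>V. (u, v) \<in> (adj_rel E)\<^sup>*)"

definition degree :: "'a set set \<Rightarrow> 'a \<Rightarrow> nat" where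
  "degree E v = card {e \<in> E. v \<in> e}"

definition max_degree :: "'a set \<Rightarrow> 'a set set \<Rightarrow> nat" where
  "max_degree V E = Max (degree E ` V)"

text \<open>A cycle (as an edge set): a nonempty connected 2-regular subgraph.\<close>
definition is_cycle_in :: "'a set set \<Rightarrow> 'a set set \<Rightarrow> bool" where
  "is_cycle_in E C \<longleftrightarrow> C \<noteq> {} \<and> C \<subseteq> E \<and> connected_graph (\<Union>C) C
     \<and> (\<forall>v\<in>\<Union>C. degree C v = 2)"

definition unicyclic :: "'a set \<Rightarrow> 'a set set \<Rightarrow> bool" where
  "unicyclic V E \<longleftrightarrow> connected_graph V E \<and> (\<exists>!C. is_cycle_in E C)"

text \<open>A subgraph (VT, ET) of (V, E) that is a tree (connected, acyclic).\<close>
definition is_subtree :: "'a set \<Rightarrow> 'a set set \<Rightarrow> 'a set \<Rightarrow> 'a set set \<Rightarrow> bool" where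
  "is_subtree V E VT ET \<longleftrightarrow> VT \<subseteq> V \<and> ET \<subseteq> E \<and> (\<forall>e\<in>ET. e \<subseteq> VT)
     \<and> connected_graph VT ET \<and> \<not> (\<exists>C. is_cycle_in ET C)"

text \<open>A tree is proper under colouring c if adjacent tree edges get different colours.\<close>
definition proper_tree :: "('a set \<Rightarrow> nat) \<Rightarrow> 'a set set \<Rightarrow> bool" where
  "proper_tree c ET \<longleftrightarrow> (\<forall>e\<in>ET. \<forall>f\<in>ET. e \<noteq> f \<and> e \<inter> f \<noteq> {} \<longrightarrow> c e \<noteq> c f)"

definition k_proper_coloring :: "'a set \<Rightarrow> 'a set set \<Rightarrow> nat \<Rightarrow> ('a set \<Rightarrow> nat) \<Rightarrow> bool" where
  "k_proper_coloring V E k c \<longleftrightarrow>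
     (\<forall>S. S \<subseteq> V \<and> card S = k \<longrightarrow>
        (\<exists>VT ET. is_subtree V E VT ET \<and> S \<subseteq> VT \<and> proper_tree c ET))"

text \<open>The k-proper index: minimum number of colours used by a k-proper colouring.\<close>
definition proper_index :: "'a set \<Rightarrow> 'a set set \<Rightarrow> nat \<Rightarrow> nat" where
  "proper_index V E k = (LEAST m. \<exists>c. k_proper_coloring V E k c \<and> card (c ` E) = m)"

end

theory Submission
  imports Defs
begin

text \<open>
  For a unicyclic graph with cycle \<open>C\<close> and \<open>k \<ge> 3\<close>, the \<open>k\<close>-proper index is the minimum over
  \<open>e \<in> C\<close> of the maximum degree of the spanning tree \<open>E - {e}\<close>; this is \<open>\<Delta> - 1\<close> if a single
  cycle edge meets all vertices of degree \<open>\<Delta>\<close>, and \<open>\<Delta>\<close> otherwise.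

  Upper bound: a tree is properly edge-colorable with as many colors as its maximum degree.

  Lower bound: any three vertices lie in a proper tree, which forces the coloring to be proper
  on \<open>E - {e}\<close> for some \<open>e \<in> C\<close>. Two adjacent bridges differ in color, since a tree through their
  far ends contains both. If a bridge \<open>g\<close> and an adjacent cycle edge \<open>h\<close> have the same color, a
  proper tree through their far ends contains \<open>g\<close>, hence omits \<open>h\<close> and contains the rest of the
  cycle; prescribing a third vertex shows that every pair of adjacent edges of equal color
  involves \<open>h\<close>. If all such pairs consist of cycle edges, a tree through the three vertices of one
  of them omits one cycle edge only and contains the rest of the cycle.
\<close>

section \<open>Graphs, reachability and degrees\<close>

lemma simple_graph_subset: "simple_graph V E \<Longrightarrow> F \<subseteq> E \<Longrightarrow> simple_graph V F"
  unfolding simple_graph_def by blast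

lemma simple_graph_edge_at:
  assumes "simple_graph V E" "e \<in> E" "v \<in> e"
  obtains w where "v \<in> V" "w \<in> V" "v \<noteq> w" "e = {v, w}"
proof -
  obtain x y where "x \<in> V" "y \<in> V" "x \<noteq> y" "e = {x, y}"
    using assms(1,2) unfolding simple_graph_def by blast
  then show thesis using that[of x] that[of y] assms(3) by (auto simp: insert_commute)
qed

lemma simple_graph_edgeE:
  assumes "simple_graph V E" "e \<in> E"
  obtains u v where "u \<in> V" "v \<in> V" "u \<noteq> v" "e = {u, v}"
  using assms unfolding simple_graph_def by blast

lemma simple_graph_edge_subset: "simple_graph V E \<Longrightarrow> e \<in> E \<Longrightarrow> e \<subseteq> V"
  by (auto elim: simple_graph_edge_at)

lemma simple_graph_finite_vertices: "simple_graph V E \<Longrightarrow> finite V"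
  by (simp add: simple_graph_def)

lemma simple_graph_finite_edges:
  assumes "simple_graph V E"
  shows "finite E"
proof (rule finite_subset)
  show "E \<subseteq> Pow V" using simple_graph_edge_subset[OF assms] by blast
  show "finite (Pow V)" using simple_graph_finite_vertices[OF assms] by simp
qed

abbreviation reachable :: "'a set set \<Rightarrow> 'a \<Rightarrow> 'a \<Rightarrow> bool" where
  "reachable E u v \<equiv> (u, v) \<in> (adj_rel E)\<^sup>*"

lemma reachable_mono: "reachable A u v \<Longrightarrow> A \<subseteq> B \<Longrightarrow> reachable B u v"
  by (rule subsetD[OF rtrancl_mono]) (auto simp: adj_rel_def)

lemma reachable_sym: "reachable E u v \<Longrightarrow> reachable E v u"
proof -
  have "sym (adj_rel E)" by (auto simp: sym_def adj_rel_def insert_commute)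
  then show "reachable E u v \<Longrightarrow> reachable E v u" by (meson sym_rtrancl symD)
qed

lemma reachable_edge: "{u, v} \<in> E \<Longrightarrow> reachable E u v"
  by (auto simp: adj_rel_def)

lemma reachable_step: "reachable E u v \<Longrightarrow> {v, w} \<in> E \<Longrightarrow> reachable E u w"
  by (rule rtrancl_trans[OF _ reachable_edge])

lemma degree_component:
  assumes G: "simple_graph V E" and "reachable E u v"
  shows "degree {e \<in> E. \<forall>x\<in>e. reachable E u x} v = degree E v"
proof -
  have "reachable E u x" if e: "e \<in> E" "v \<in> e" and "x \<in> e" for e x
  proof -
    obtain w where "e = {v, w}" using simple_graph_edge_at[OF G e] .
    then show ?thesis using assms(2) e(1) \<open>x \<in> e\<close> by (auto intro: reachable_step)
  qed
  then have "{e \<in> {e \<in> E. \<forall>x\<in>e. reachable E u x}. v \<in> e} = {e \<in> E. v \<in> e}" by blast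
  then show ?thesis by (simp only: degree_def)
qed

lemma degree_insert:
  assumes "finite F" "e \<notin> F"
  shows "degree (insert e F) v = degree F v + (if v \<in> e then 1 else 0)"
proof -
  have "{f \<in> insert e F. v \<in> f} = (if v \<in> e then insert e {f \<in> F. v \<in> f} else {f \<in> F. v \<in> f})"
    by auto
  then show ?thesis using assms by (simp add: degree_def)
qed

lemma degree_delete:
  assumes "finite E" "e \<in> E"
  shows "degree E v = degree (E - {e}) v + (if v \<in> e then 1 else 0)"
  using degree_insert[of "E - {e}" e v] assms by (simp add: insert_absorb)

lemma degree_eq_0: "v \<notin> \<Union>E \<Longrightarrow> degree E v = 0"
  unfolding degree_def by (metis (mono_tags, lifting) UnionI card.empty empty_Collect_eq)

lemma degree_mono: "finite B \<Longrightarrow> A \<subseteq> B \<Longrightarrow> degree A v \<le> degree B v"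
  unfolding degree_def by (rule card_mono) auto

lemma sum_degree_eq_twice_card_edges:
  assumes "simple_graph V E"
  shows "(\<Sum>v\<in>V. degree E v) = 2 * card E"
proof -
  have "card {v \<in> V. v \<in> e} = 2" if e: "e \<in> E" for e
  proof -
    have "{v \<in> V. v \<in> e} = e" using simple_graph_edge_subset[OF assms e] by blast
    moreover obtain x y where "x \<noteq> y" "e = {x, y}" using simple_graph_edgeE[OF assms e] by metis
    ultimately show ?thesis by simp
  qed
  then show ?thesis
    unfolding degree_def
    using simple_graph_finite_vertices[OF assms] simple_graph_finite_edges[OF assms]
    by (intro sum_multicount) auto
qed

section \<open>Paths\<close>

inductive is_path :: "'a \<Rightarrow> 'a set set \<Rightarrow> 'a \<Rightarrow> bool" for u where
  single_edge: "u \<noteq> v \<Longrightarrow> is_path u {{u, v}} v"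
| append_edge: "is_path u P y \<Longrightarrow> z \<notin> \<Union>P \<Longrightarrow> is_path u (insert {y, z} P) z"

lemma is_path_finite: "is_path u P v \<Longrightarrow> finite P"
  by (induction rule: is_path.induct) auto

lemma is_path_ends:
  assumes "is_path u P v"
  shows "u \<in> \<Union>P" "v \<in> \<Union>P" "u \<noteq> v"
  using assms by induction auto

lemma is_path_degree:
  assumes "is_path u P v" "w \<in> \<Union>P"
  shows "degree P w = (if w = u \<or> w = v then 1 else 2)"
  using assms
proof (induction arbitrary: w)
  case (single_edge v)
  then have "{f \<in> {{u, v}}. w \<in> f} = {{u, v}}" by auto
  then show ?case using single_edge by (auto simp: degree_def)
next
  case (append_edge P y z)
  note path = append_edge.hyps(1)
  have deg: "degree (insert {y, z} P) w = degree P w + (if w \<in> {y, z} then 1 else 0)"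
    using degree_insert is_path_finite[OF path] append_edge.hyps(2) by (metis UnionI insert_iff)
  note ends = is_path_ends[OF path]
  show ?case
  proof (cases "w = z")
    case True
    then show ?thesis using deg degree_eq_0[OF append_edge.hyps(2)] by simp
  next
    case False
    then have "w \<in> \<Union>P" using append_edge.prems ends(2) by auto
    then show ?thesis using append_edge.IH deg ends(3) False by auto
  qed
qed

lemma is_path_prefix:
  assumes "is_path u P v" "w \<in> \<Union>P" "w \<noteq> u"
  shows "\<exists>Q\<subseteq>P. is_path u Q w"
  using assms
proof (induction arbitrary: w)
  case (single_edge v)
  then have "w = v" by auto
  then show ?case using is_path.single_edge[OF single_edge.hyps] by blast
next
  case (append_edge P y z)
  have "y \<in> \<Union>P" using is_path_ends[OF append_edge.hyps(1)] by simp
  then consider "w \<in> \<Union>P" | "w = z" using append_edge.prems by auto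
  then show ?case
  proof cases
    assume "w \<in> \<Union>P"
    then show ?thesis using append_edge.IH[OF _ append_edge.prems(2)] by blast
  next
    assume "w = z"
    then show ?thesis using is_path.append_edge[OF append_edge.hyps] by blast
  qed
qed

lemma is_path_reachable:
  assumes "is_path u P v" "w \<in> \<Union>P"
  shows "reachable P u w"
  using assms
proof (induction arbitrary: w)
  case (single_edge v)
  then show ?case by (auto simp: adj_rel_def)
next
  case (append_edge P y z)
  let ?P = "insert {y, z} P"
  have reach: "reachable ?P u x" if "x \<in> \<Union>P" for x
    using append_edge.IH[OF that] by (rule reachable_mono) auto
  have y: "y \<in> \<Union>P" using is_path_ends[OF append_edge.hyps(1)] by simp
  then have "reachable ?P u z" using reachable_step[OF reach] by simp
  then show ?case using reach y append_edge.prems by blast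
qed

lemma reachable_imp_path:
  assumes "reachable E u v" "u \<noteq> v"
  shows "\<exists>P\<subseteq>E. is_path u P v"
  using assms
proof induction
  case base
  then show ?case by simp
next
  case (step y z)
  have yz: "{y, z} \<in> E" using step.hyps(2) by (simp add: adj_rel_def)
  show ?case
  proof (cases "u = y")
    case True
    then show ?thesis using yz is_path.single_edge[OF step.prems] by blast
  next
    case False
    then obtain P where P: "P \<subseteq> E" "is_path u P y" using step.IH by blast
    show ?thesis
    proof (cases "z \<in> \<Union>P")
      case True
      then show ?thesis using is_path_prefix[OF P(2) True] step.prems P(1) by blast
    next
      case False
      then show ?thesis using is_path.append_edge[OF P(2) False] P(1) yz
        by (meson insert_subsetI)
    qed
  qed
qed

lemma connected_graph_degree_pos:
  assumes "connected_graph V E" "finite E" "u \<in> V" "v \<in> V" "u \<noteq> v"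
  shows "0 < degree E u"
proof -
  have "reachable E u v" using assms unfolding connected_graph_def by blast
  then obtain P where P: "P \<subseteq> E" "is_path u P v" using reachable_imp_path assms(5) by metis
  then have "degree P u = 1" using is_path_degree is_path_ends(1) by metis
  then show ?thesis using degree_mono[OF assms(2) P(1), of u] by simp
qed

section \<open>Bridges and cycles\<close>

definition is_bridge :: "'a set set \<Rightarrow> 'a set \<Rightarrow> bool" where
  "is_bridge E e \<longleftrightarrow> (\<forall>u v. e = {u, v} \<longrightarrow> \<not> reachable (E - {e}) u v)"

lemma is_bridge_doubleton: "is_bridge E {u, v} \<longleftrightarrow> \<not> reachable (E - {{u, v}}) u v"
  unfolding is_bridge_def by (auto simp: doubleton_eq_iff intro: reachable_sym)

lemma is_bridge_antimono: "is_bridge F e \<Longrightarrow> E \<subseteq> F \<Longrightarrow> is_bridge E e"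
  unfolding is_bridge_def using reachable_mono by (metis Diff_mono subset_refl)

lemma is_cycle_in_mono: "is_cycle_in E C \<Longrightarrow> E \<subseteq> F \<Longrightarrow> is_cycle_in F C"
  unfolding is_cycle_in_def by blast

lemma even_degrees_not_bridge:
  assumes G: "simple_graph V E" and even: "\<And>v. v \<in> V \<Longrightarrow> even (degree E v)" and e: "e \<in> E"
  shows "\<not> is_bridge E e"
proof
  assume bridge: "is_bridge E e"
  obtain u v where uv: "u \<in> V" "e = {u, v}" using simple_graph_edgeE[OF G e] by metis
  define W where "W = {w \<in> V. reachable (E - {e}) u w}"
  define F where "F = {f \<in> E - {e}. \<forall>x\<in>f. reachable (E - {e}) u x}"
  have "v \<notin> W" using bridge uv(2) by (simp add: W_def is_bridge_doubleton)
  have "u \<in> W" using uv(1) by (simp add: W_def)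
  have "odd (degree F w) \<longleftrightarrow> w = u" if w: "w \<in> W" for w
  proof -
    have "degree E w = degree F w + (if w \<in> e then 1 else 0)"
      using degree_delete[OF simple_graph_finite_edges[OF G] e]
        degree_component[OF simple_graph_subset[OF G Diff_subset], of u w "{e}"] w
      unfolding F_def W_def by simp
    moreover have "even (degree E w)" using even w by (simp add: W_def)
    moreover have "w \<in> e \<longleftrightarrow> w = u" using uv(2) w \<open>v \<notin> W\<close> by auto
    ultimately show ?thesis by (auto split: if_splits)
  qed
  then have odd_vertices: "{w \<in> W. odd (degree F w)} = {u}" using \<open>u \<in> W\<close> by auto
  have "simple_graph W F"
    using G unfolding simple_graph_def F_def W_def by fastforce
  then have "even (\<Sum>w\<in>W. degree F w)" "finite W"
    using sum_degree_eq_twice_card_edges simple_graph_finite_vertices by fastforce+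
  then show False using even_sum_iff[of W "degree F"] odd_vertices by simp
qed

lemma cycle_edge_not_bridge:
  assumes G: "simple_graph V E" and C: "is_cycle_in E C" and e: "e \<in> C"
  shows "\<not> is_bridge E e"
proof -
  have "C \<subseteq> E" using C by (simp add: is_cycle_in_def)
  moreover have "even (degree C v)" for v
    using C degree_eq_0[of v C] by (cases "v \<in> \<Union>C") (auto simp: is_cycle_in_def)
  ultimately show ?thesis
    using even_degrees_not_bridge[OF simple_graph_subset[OF G]] e is_bridge_antimono by metis
qed

lemma is_path_close_cycle:
  assumes path: "is_path u P v" and "{u, v} \<notin> P"
  shows "is_cycle_in (insert {u, v} P) (insert {u, v} P)"
proof -
  let ?C = "insert {u, v} P"
  note ends = is_path_ends[OF path]
  have vertices: "\<Union>?C = \<Union>P" using ends by auto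
  have "reachable ?C u w" if "w \<in> \<Union>P" for w
    using is_path_reachable[OF path that] by (rule reachable_mono) auto
  then have "connected_graph (\<Union>?C) ?C"
    unfolding connected_graph_def vertices
    using ends(1) by (blast intro: rtrancl_trans reachable_sym)
  moreover have "degree ?C w = 2" if "w \<in> \<Union>P" for w
    using degree_insert[OF is_path_finite[OF path] assms(2)] is_path_degree[OF path that] ends(3)
    by auto
  ultimately show ?thesis unfolding is_cycle_in_def vertices by blast
qed

lemma is_bridge_iff_not_in_cycle:
  assumes G: "simple_graph V E" and e: "e \<in> E"
  shows "is_bridge E e \<longleftrightarrow> (\<forall>C. is_cycle_in E C \<longrightarrow> e \<notin> C)"
proof
  show "\<forall>C. is_cycle_in E C \<longrightarrow> e \<notin> C" if "is_bridge E e"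
    using cycle_edge_not_bridge[OF G] that by blast
  show "is_bridge E e" if no_cycle: "\<forall>C. is_cycle_in E C \<longrightarrow> e \<notin> C"
  proof (rule ccontr)
    assume not_bridge: "\<not> is_bridge E e"
    obtain u v where uv: "u \<noteq> v" "e = {u, v}" using simple_graph_edgeE[OF G e] by metis
    then have "reachable (E - {e}) u v" using not_bridge by (simp add: is_bridge_doubleton)
    then obtain P where P: "P \<subseteq> E - {e}" "is_path u P v" using reachable_imp_path uv(1) by metis
    then have "is_cycle_in (insert e P) (insert e P)"
      using is_path_close_cycle[OF P(2)] uv(2) by blast
    moreover have "insert e P \<subseteq> E" using P(1) e by blast
    ultimately show False using is_cycle_in_mono no_cycle by (metis insertI1)
  qed
qed

lemma connected_graph_delete_not_bridge:
  assumes conn: "connected_graph V E" and "\<not> is_bridge E e"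
  shows "connected_graph V (E - {e})"
proof -
  obtain u v where uv: "e = {u, v}" "reachable (E - {e}) u v"
    using assms(2) unfolding is_bridge_def by blast
  have "reachable (E - {e}) x y" if "{x, y} \<in> E" for x y
  proof (cases "{x, y} = e")
    case True
    then show ?thesis using uv reachable_sym by (metis doubleton_eq_iff)
  next
    case False
    then show ?thesis using that by (intro reachable_edge) auto
  qed
  then have "adj_rel E \<subseteq> (adj_rel (E - {e}))\<^sup>*" by (auto simp: adj_rel_def)
  then have "(adj_rel E)\<^sup>* \<subseteq> (adj_rel (E - {e}))\<^sup>*" by (rule rtrancl_subset_rtrancl)
  then show ?thesis using conn unfolding connected_graph_def by blast
qed

lemma connected_subgraph_contains_bridge:
  assumes "is_bridge E {v, w}"
    and T: "connected_graph VT ET" "ET \<subseteq> E" "x \<in> VT" "y \<in> VT"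
    and "reachable (E - {{v, w}}) v x" "reachable (E - {{v, w}}) y w"
  shows "{v, w} \<in> ET"
proof (rule ccontr)
  assume "{v, w} \<notin> ET"
  then have "ET \<subseteq> E - {{v, w}}" using T(2) by blast
  moreover have "reachable ET x y" using T unfolding connected_graph_def by blast
  ultimately have "reachable (E - {{v, w}}) x y" by (blast intro: reachable_mono)
  then have "reachable (E - {{v, w}}) v w" using assms(6,7) by (meson rtrancl_trans)
  then show False using assms(1) by (simp add: is_bridge_doubleton)
qed

section \<open>Proper edge-colorings of forests\<close>

definition forest :: "'a set set \<Rightarrow> bool" where
  "forest F \<longleftrightarrow> \<not> (\<exists>C. is_cycle_in F C)"

lemma forest_subset: "forest F \<Longrightarrow> F' \<subseteq> F \<Longrightarrow> forest F'"
  unfolding forest_def using is_cycle_in_mono by blast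

lemma forest_is_bridge: "simple_graph V F \<Longrightarrow> forest F \<Longrightarrow> e \<in> F \<Longrightarrow> is_bridge F e"
  unfolding forest_def using is_bridge_iff_not_in_cycle by metis

lemma forest_has_leaf:
  assumes G: "simple_graph V F" and F: "forest F" "F \<noteq> {}"
  shows "\<exists>v. degree F v = 1"
proof -
  obtain u w where "u \<noteq> w" "{u, w} \<in> F"
    using F(2) simple_graph_edgeE[OF G] by (metis ex_in_conv)
  define paths where "paths = {P. P \<subseteq> F \<and> (\<exists>v. is_path u P v)}"
  have "paths \<subseteq> Pow F" by (auto simp: paths_def)
  then have "finite paths" using simple_graph_finite_edges[OF G] by (simp add: finite_subset)
  moreover have "{{u, w}} \<in> paths"
    using is_path.single_edge[OF \<open>u \<noteq> w\<close>] \<open>{u, w} \<in> F\<close> by (auto simp: paths_def)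
  ultimately obtain P where P: "P \<in> paths" "\<And>Q. Q \<in> paths \<Longrightarrow> P \<subseteq> Q \<Longrightarrow> P = Q"
    using finite_has_maximal[of paths] by blast
  then obtain v where path: "P \<subseteq> F" "is_path u P v" by (auto simp: paths_def)
  have "f \<in> P" if f: "f \<in> F" "v \<in> f" for f
  proof (rule ccontr)
    assume "f \<notin> P"
    obtain z where z: "f = {v, z}" using simple_graph_edge_at[OF G f] by metis
    show False
    proof (cases "z \<in> \<Union>P")
      case True
      then have "reachable P v z"
        using is_path_reachable[OF path(2)] is_path_ends(2)[OF path(2)]
        by (meson reachable_sym rtrancl_trans)
      then have "reachable (F - {f}) v z"
        by (rule reachable_mono) (use path(1) \<open>f \<notin> P\<close> in blast)
      then show False using forest_is_bridge[OF G F(1) f(1)] z by (simp add: is_bridge_def)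
    next
      case False
      then have "insert f P \<in> paths"
        using is_path.append_edge[OF path(2)] path(1) f(1) z by (auto simp: paths_def)
      then show False using P(2) \<open>f \<notin> P\<close> by blast
    qed
  qed
  then have "{f \<in> F. v \<in> f} = {f \<in> P. v \<in> f}" using path(1) by blast
  then have "degree F v = degree P v" by (simp add: degree_def)
  then show ?thesis using is_path_degree is_path_ends(2) path(2) by metis
qed

lemma free_color_at_vertex:
  assumes "finite F" "degree F v < D"
  obtains a where "a < D" "\<And>f. f \<in> F \<Longrightarrow> v \<in> f \<Longrightarrow> c f \<noteq> (a :: nat)"
proof -
  have "card (c ` {f \<in> F. v \<in> f}) < card {..<D}"
    using assms card_image_le[of "{f \<in> F. v \<in> f}" c] by (simp add: degree_def)
  then have "\<not> {..<D} \<subseteq> c ` {f \<in> F. v \<in> f}"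
    using card_mono[of "c ` {f \<in> F. v \<in> f}" "{..<D}"] assms(1) by fastforce
  then show thesis using that by blast
qed

lemma forest_proper_coloring:
  assumes "simple_graph V F" "forest F" "\<And>v. v \<in> V \<Longrightarrow> degree F v \<le> D"
  shows "\<exists>c. c ` F \<subseteq> {..<D} \<and> proper_tree c F"
  using simple_graph_finite_edges[OF assms(1)] assms
proof (induction F rule: finite_psubset_induct)
  case (psubset F)
  note G = psubset.prems(1)
  show ?case
  proof (cases "F = {}")
    case True
    then show ?thesis by (simp add: proper_tree_def)
  next
    case False
    then obtain v where "degree F v = 1" using forest_has_leaf[OF G psubset.prems(2)] by blast
    then obtain e where leaf: "{f \<in> F. v \<in> f} = {e}"
      unfolding degree_def by (elim card_1_singletonE)
    then have e: "e \<in> F" "v \<in> e" by blast+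
    obtain u where u: "u \<in> V" "e = {v, u}" using simple_graph_edge_at[OF G e] by metis
    have "\<exists>c. c ` (F - {e}) \<subseteq> {..<D} \<and> proper_tree c (F - {e})"
    proof (rule psubset.IH)
      show "F - {e} \<subset> F" using e(1) by blast
      show "simple_graph V (F - {e})" using simple_graph_subset[OF G] by blast
      show "forest (F - {e})" using forest_subset[OF psubset.prems(2)] by blast
      show "degree (F - {e}) w \<le> D" if "w \<in> V" for w
        using psubset.prems(3)[OF that] degree_delete[OF psubset.hyps e(1), of w] by simp
    qed
    then obtain c where c: "c ` (F - {e}) \<subseteq> {..<D}" "proper_tree c (F - {e})" by blast
    have "degree (F - {e}) u < D"
      using psubset.prems(3)[OF u(1)] degree_delete[OF psubset.hyps e(1), of u] u(2) by simp
    then obtain a where a: "a < D" "\<And>f. f \<in> F - {e} \<Longrightarrow> u \<in> f \<Longrightarrow> c f \<noteq> a"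
      using free_color_at_vertex[of "F - {e}" u D c] psubset.hyps by blast
    have "c f \<noteq> a" if "f \<in> F - {e}" "e \<inter> f \<noteq> {}" for f
      using that a(2) leaf u(2) by blast
    then have "proper_tree (c(e := a)) F"
      using c(2) unfolding proper_tree_def by (auto simp: Int_commute)
    moreover have "c(e := a) ` F \<subseteq> {..<D}" using c(1) a(1) by auto
    ultimately show ?thesis by blast
  qed
qed

lemma proper_tree_subset: "proper_tree c F \<Longrightarrow> F' \<subseteq> F \<Longrightarrow> proper_tree c F'"
  unfolding proper_tree_def by blast

lemma proper_tree_degree_le_card_colors:
  assumes "proper_tree c F" "finite F"
  shows "degree F v \<le> card (c ` F)"
proof -
  have "inj_on c {f \<in> F. v \<in> f}"
    using assms(1) unfolding proper_tree_def by (intro inj_onI) blast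
  then show ?thesis
    unfolding degree_def using assms(2) by (intro card_inj_on_le[of c]) auto
qed

section \<open>Vertices of maximum degree\<close>

definition max_degree_vertices :: "'a set \<Rightarrow> 'a set set \<Rightarrow> 'a set" where
  "max_degree_vertices V E = {v \<in> V. degree E v = max_degree V E}"

lemma degree_le_max_degree: "finite V \<Longrightarrow> v \<in> V \<Longrightarrow> degree E v \<le> max_degree V E"
  by (simp add: max_degree_def)

lemma max_degree_vertices_nonempty:
  assumes "finite V" "V \<noteq> {}"
  shows "max_degree_vertices V E \<noteq> {}"
proof -
  have "max_degree V E \<in> degree E ` V"
    unfolding max_degree_def using assms by (intro Max_in) auto
  then show ?thesis by (auto simp: max_degree_vertices_def)
qed

lemma max_degree_delete_edge:
  assumes G: "simple_graph V E" and e: "e \<in> E"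
  shows "max_degree V (E - {e}) =
    (if max_degree_vertices V E \<subseteq> e then max_degree V E - 1 else max_degree V E)"
    (is "_ = ?d")
proof -
  note finV = simple_graph_finite_vertices[OF G]
  note deg = degree_delete[OF simple_graph_finite_edges[OF G] e]
  have "V \<noteq> {}" using simple_graph_edgeE[OF G e] by blast
  then obtain m where m: "m \<in> V" "degree E m = max_degree V E"
    "max_degree_vertices V E \<subseteq> e \<longleftrightarrow> m \<in> e"
    using max_degree_vertices_nonempty[OF finV, of E] unfolding max_degree_vertices_def by blast
  have "degree (E - {e}) v \<le> ?d" if v: "v \<in> V" for v
  proof -
    have "degree E v \<noteq> max_degree V E" if "max_degree_vertices V E \<subseteq> e" "v \<notin> e"
      using that v by (auto simp: max_degree_vertices_def)
    then show ?thesis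
      using degree_le_max_degree[OF finV v, of E] deg[of v] by (cases "v \<in> e") auto
  qed
  moreover have "degree (E - {e}) m = ?d" using m deg[of m] by (cases "m \<in> e") auto
  ultimately show ?thesis
    unfolding max_degree_def[of V "E - {e}"]
    using finV m(1) by (intro Max_eqI) (auto simp only: finite_imageI intro!: rev_image_eqI[of m])
qed

section \<open>Proper indices\<close>

lemma k_proper_coloring_obtain_tree:
  assumes "k_proper_coloring V E k c" "finite V" "k \<le> card V" "S \<subseteq> V" "card S \<le> k"
  obtains VT ET where "is_subtree V E VT ET" "S \<subseteq> VT" "proper_tree c ET"
proof -
  obtain S' where S': "S \<subseteq> S'" "S' \<subseteq> V" "card S' = k"
    using exists_subset_between[of S k V] assms(2-5) by auto
  then obtain VT ET where "is_subtree V E VT ET" "S' \<subseteq> VT" "proper_tree c ET"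
    using assms(1) unfolding k_proper_coloring_def by metis
  then show thesis using that[of VT ET] S'(1) by simp
qed

lemma spanning_tree_k_proper_coloring:
  assumes G: "simple_graph V E" and T: "is_subtree V E V F" and pos: "0 < max_degree V F"
  shows "\<exists>c. k_proper_coloring V E k c \<and> card (c ` E) \<le> max_degree V F"
proof -
  have F: "F \<subseteq> E" "forest F" using T by (auto simp: is_subtree_def forest_def)
  have "degree F v \<le> max_degree V F" if "v \<in> V" for v
    using degree_le_max_degree[OF simple_graph_finite_vertices[OF G] that] .
  then obtain c where c: "c ` F \<subseteq> {..<max_degree V F}" "proper_tree c F"
    using forest_proper_coloring[OF simple_graph_subset[OF G F(1)] F(2)] by metis
  define c' where "c' f = (if f \<in> F then c f else 0)" for f
  have "proper_tree c' F" using c(2) by (simp add: proper_tree_def c'_def)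
  then have "k_proper_coloring V E k c'" using T unfolding k_proper_coloring_def by metis
  moreover have "c' ` E \<subseteq> {..<max_degree V F}" using c(1) pos by (auto simp: c'_def)
  then have "card (c' ` E) \<le> card {..<max_degree V F}" by (intro card_mono) auto
  ultimately show ?thesis by auto
qed

lemma proper_index_eqI:
  assumes "k_proper_coloring V E k c" "card (c ` E) \<le> m"
    and lower: "\<And>c'. k_proper_coloring V E k c' \<Longrightarrow> m \<le> card (c' ` E)"
  shows "proper_index V E k = m"
  unfolding proper_index_def
proof (rule Least_equality)
  have "card (c ` E) = m" using assms(2) lower[OF assms(1)] by simp
  then show "\<exists>c. k_proper_coloring V E k c \<and> card (c ` E) = m" using assms(1) by blast
qed (use lower in blast)

section \<open>Unicyclic graphs\<close>

locale unicyclic_graph =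
  fixes V :: "'a set" and E C :: "'a set set"
  assumes simple: "simple_graph V E"
    and conn: "connected_graph V E"
    and cycle_iff: "is_cycle_in E C' \<longleftrightarrow> C' = C"
begin

lemmas finite_V = simple_graph_finite_vertices[OF simple]
lemmas finite_E = simple_graph_finite_edges[OF simple]

lemma cycle: "is_cycle_in E C"
  using cycle_iff by simp

lemma cycle_subset: "C \<subseteq> E"
  using cycle by (simp add: is_cycle_in_def)

lemma finite_cycle: "finite C"
  using cycle_subset finite_E by (rule finite_subset)

lemma cycle_edgeE:
  assumes "e \<in> C"
  obtains u v where "u \<in> V" "v \<in> V" "u \<noteq> v" "e = {u, v}"
  using simple_graph_edgeE[OF simple subsetD[OF cycle_subset assms]] .

lemma cycle_nonempty: "C \<noteq> {}"
  using cycle by (simp add: is_cycle_in_def)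

lemma is_bridge_iff: "e \<in> E \<Longrightarrow> is_bridge E e \<longleftrightarrow> e \<notin> C"
  using is_bridge_iff_not_in_cycle[OF simple] cycle_iff by simp

lemma forest_delete_cycle_edge:
  assumes "e \<in> C"
  shows "forest (E - {e})"
proof -
  have False if C': "is_cycle_in (E - {e}) C'" for C'
  proof -
    have "C' = C" using is_cycle_in_mono[OF C'] cycle_iff by blast
    moreover have "e \<notin> C'" using C' by (auto simp: is_cycle_in_def)
    ultimately show False using assms by simp
  qed
  then show ?thesis unfolding forest_def by blast
qed

lemma spanning_tree_delete_cycle_edge:
  assumes "e \<in> C"
  shows "is_subtree V E V (E - {e})"
proof -
  have "\<not> is_bridge E e" using assms is_bridge_iff cycle_subset by blast
  then show ?thesis
    using connected_graph_delete_not_bridge[OF conn] forest_delete_cycle_edge[OF assms]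
      simple_graph_edge_subset[OF simple]
    unfolding is_subtree_def forest_def by blast
qed

lemma edge_between_cycle_vertices:
  assumes "u \<in> \<Union>C" "v \<in> \<Union>C" "{u, v} \<in> E"
  shows "{u, v} \<in> C"
proof (rule ccontr)
  assume not_in_cycle: "{u, v} \<notin> C"
  have "reachable C u v"
    using cycle assms(1,2) unfolding is_cycle_in_def connected_graph_def by blast
  then have "reachable (E - {{u, v}}) u v"
    by (rule reachable_mono) (use not_in_cycle cycle_subset in blast)
  then show False using is_bridge_iff[OF assms(3)] not_in_cycle by (simp add: is_bridge_doubleton)
qed

lemma subtree_contains_bridge:
  assumes T: "is_subtree V E VT ET" and "{v, w} \<in> E - C" "w \<in> VT"
    and x: "x \<in> VT" "x = v \<or> {v, x} \<in> E - {{v, w}}"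
  shows "{v, w} \<in> ET"
proof (rule connected_subgraph_contains_bridge)
  show "is_bridge E {v, w}" using is_bridge_iff assms(2) by blast
  show "reachable (E - {{v, w}}) v x"
    using x(2) by (blast intro: reachable_edge)
qed (use T assms(3) x(1) in \<open>auto simp: is_subtree_def\<close>)

lemma subtree_contains_rest_of_cycle:
  assumes T: "is_subtree V E VT ET" and e: "e \<in> C" "e \<subseteq> VT" "e \<notin> ET"
  shows "C - {e} \<subseteq> ET"
proof
  fix f assume f: "f \<in> C - {e}"
  show "f \<in> ET"
  proof (rule ccontr)
    assume "f \<notin> ET"
    obtain a b where ab: "e = {a, b}" using cycle_edgeE[OF e(1)] by metis
    have "is_bridge (E - {f}) e"
      using forest_is_bridge[OF simple_graph_subset[OF simple] forest_delete_cycle_edge] f e(1)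
        cycle_subset by blast
    then have "e \<in> ET"
      using connected_subgraph_contains_bridge[of "E - {f}" a b VT ET a b] T e(2) ab \<open>f \<notin> ET\<close>
      by (auto simp: is_subtree_def)
    then show False using e(3) by simp
  qed
qed

lemma max_degree_vertices_subset_cycle_edge_iff:
  "(\<exists>e\<in>C. max_degree_vertices V E \<subseteq> e) \<longleftrightarrow>
    card (max_degree_vertices V E) \<le> 2 \<and> max_degree_vertices V E \<subseteq> \<Union>C \<and>
    (\<forall>u\<in>max_degree_vertices V E. \<forall>v\<in>max_degree_vertices V E. u \<noteq> v \<longrightarrow> {u, v} \<in> E)"
  (is "(\<exists>e\<in>C. ?M \<subseteq> e) \<longleftrightarrow> ?conditions")
proof
  assume "\<exists>e\<in>C. ?M \<subseteq> e"
  then obtain e where e: "e \<in> C" "?M \<subseteq> e" by blast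
  then obtain p q where pq: "p \<noteq> q" "e = {p, q}" using cycle_edgeE by metis
  have "card ?M \<le> card e" using e(2) pq by (intro card_mono) auto
  moreover have "{u, v} = e" if "u \<in> ?M" "v \<in> ?M" "u \<noteq> v" for u v using that e(2) pq by auto
  ultimately show ?conditions using e pq cycle_subset by auto
next
  assume conditions: ?conditions
  have "finite ?M" using finite_V by (simp add: max_degree_vertices_def)
  moreover have "?M \<noteq> {}"
    using max_degree_vertices_nonempty[OF finite_V] conn by (simp add: connected_graph_def)
  ultimately have "card ?M = 1 \<or> card ?M = 2"
    using conditions card_gt_0_iff[of ?M] by linarith
  then consider (one) m where "?M = {m}" | (two) u v where "?M = {u, v}" "u \<noteq> v"
    by (metis card_1_singletonE card_2_iff)
  then show "\<exists>e\<in>C. ?M \<subseteq> e"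
  proof cases
    case one
    then show ?thesis using conditions by auto
  next
    case (two u v)
    then have "{u, v} \<in> C" using conditions by (intro edge_between_cycle_vertices) auto
    then show ?thesis using two by blast
  qed
qed

end

section \<open>Colorings with equally colored adjacent edges\<close>

definition color_clash :: "('a set \<Rightarrow> nat) \<Rightarrow> 'a set \<Rightarrow> 'a set \<Rightarrow> bool" where
  "color_clash c g h \<longleftrightarrow> g \<noteq> h \<and> g \<inter> h \<noteq> {} \<and> c g = c h"

lemma color_clash_sym: "color_clash c g h \<Longrightarrow> color_clash c h g"
  by (auto simp: color_clash_def)

lemma proper_tree_iff_no_clash:
  "proper_tree c F \<longleftrightarrow> (\<forall>g\<in>F. \<forall>h\<in>F. \<not> color_clash c g h)"
  unfolding proper_tree_def color_clash_def by blast

lemma color_clash_obtain_ends: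
  assumes G: "simple_graph V E" and gh: "g \<in> E" "h \<in> E" "color_clash c g h"
  obtains v x y where "v \<in> V" "x \<in> V" "y \<in> V" "g = {v, x}" "h = {v, y}"
proof -
  obtain v where v: "v \<in> g" "v \<in> h" using gh(3) by (auto simp: color_clash_def)
  obtain x where "v \<in> V" "x \<in> V" "g = {v, x}" using simple_graph_edge_at[OF G gh(1) v(1)] .
  moreover obtain y where "y \<in> V" "h = {v, y}" using simple_graph_edge_at[OF G gh(2) v(2)] .
  ultimately show thesis using that by metis
qed

context unicyclic_graph
begin

context
  fixes c :: "'a set \<Rightarrow> nat" and k :: nat
  assumes coloring: "k_proper_coloring V E k c" and k: "3 \<le> k" "k \<le> card V"
begin

lemma obtain_proper_tree_through_three:
  assumes "x \<in> V" "y \<in> V" "z \<in> V"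
  obtains VT ET where "is_subtree V E VT ET" "x \<in> VT" "y \<in> VT" "z \<in> VT" "proper_tree c ET"
proof -
  have "card {x, y, z} \<le> k" using k(1) by (simp add: card_insert_if)
  then show thesis
    using k_proper_coloring_obtain_tree[OF coloring finite_V k(2), of "{x, y, z}"] assms that
    by auto
qed

lemma color_clash_meets_cycle:
  assumes clash: "color_clash c g h" and gh: "g \<in> E" "h \<in> E"
  shows "g \<in> C \<or> h \<in> C"
proof (rule ccontr)
  assume bridges: "\<not> (g \<in> C \<or> h \<in> C)"
  obtain v x y where ends: "x \<in> V" "y \<in> V" "g = {v, x}" "h = {v, y}"
    using color_clash_obtain_ends[OF simple gh clash] by metis
  obtain VT ET where T: "is_subtree V E VT ET" "x \<in> VT" "y \<in> VT" "proper_tree c ET"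
    using obtain_proper_tree_through_three[OF ends(1,2,2)] by metis
  have "g \<noteq> h" using clash by (simp add: color_clash_def)
  then have "g \<in> ET" "h \<in> ET"
    using subtree_contains_bridge[OF T(1), of v x y] subtree_contains_bridge[OF T(1), of v y x]
      T(2,3) ends(3,4) gh bridges by simp_all
  then show False using T(4) clash by (auto simp: proper_tree_iff_no_clash)
qed

lemma bridge_cycle_clash_edge_in_clash:
  assumes gh: "color_clash c g h" "g \<in> E - C" "h \<in> C"
    and pq: "color_clash c p q" "p \<in> E" "q \<in> C"
  shows "h = p \<or> h = q"
proof (rule ccontr)
  assume distinct: "\<not> (h = p \<or> h = q)"
  have "g \<in> E" "h \<in> E" "q \<in> E" using gh(2,3) pq(3) cycle_subset by auto
  obtain v w z where ends: "w \<in> V" "z \<in> V" "g = {v, w}" "h = {v, z}"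
    using color_clash_obtain_ends[OF simple \<open>g \<in> E\<close> \<open>h \<in> E\<close> gh(1)] by metis
  obtain u t s where ut: "t \<in> V" "p = {u, t}" "q = {u, s}"
    using color_clash_obtain_ends[OF simple pq(2) \<open>q \<in> E\<close> pq(1)] by metis
  obtain VT ET where T: "is_subtree V E VT ET" "w \<in> VT" "z \<in> VT" "t \<in> VT" "proper_tree c ET"
    using obtain_proper_tree_through_three[OF ends(1,2) ut(1)] by metis
  have ET_VT: "f \<subseteq> VT" if "f \<in> ET" for f using T(1) that by (auto simp: is_subtree_def)
  have "g \<in> ET"
    using subtree_contains_bridge[OF T(1), of v w z] T(2,3) ends(3,4) gh(2,3) \<open>h \<in> E\<close> by auto
  then have "h \<notin> ET" "h \<subseteq> VT"
    using gh(1) T(3,5) ET_VT ends(3,4) by (auto simp: proper_tree_iff_no_clash)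
  then have rest: "C - {h} \<subseteq> ET" using subtree_contains_rest_of_cycle[OF T(1) gh(3)] by blast
  then have "q \<in> ET" using pq(3) distinct by blast
  moreover have "p \<in> ET"
  proof (cases "p \<in> C")
    case True
    then show ?thesis using rest distinct by blast
  next
    case False
    have "u \<in> VT" using ET_VT[OF \<open>q \<in> ET\<close>] ut(3) by simp
    then show ?thesis
      using subtree_contains_bridge[OF T(1), of u t u] T(4) False pq(2) ut(2) by simp
  qed
  ultimately show False using T(5) pq(1) by (auto simp: proper_tree_iff_no_clash)
qed

lemma proper_cycle_delete_edge:
  assumes clash: "color_clash c g h" and gh: "g \<in> C" "h \<in> C"
  shows "\<exists>e\<in>C. proper_tree c (C - {e})"
proof -
  obtain v x y where ends: "v \<in> V" "x \<in> V" "y \<in> V" "g = {v, x}" "h = {v, y}"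
    using color_clash_obtain_ends[OF simple subsetD[OF cycle_subset gh(1)]
        subsetD[OF cycle_subset gh(2)] clash] .
  obtain VT ET where T: "is_subtree V E VT ET" "v \<in> VT" "x \<in> VT" "y \<in> VT" "proper_tree c ET"
    using obtain_proper_tree_through_three[OF ends(1-3)] by metis
  obtain e where e: "e \<in> {g, h}" "e \<notin> ET"
    using T(5) clash by (auto simp: proper_tree_iff_no_clash)
  then have "e \<in> C" "e \<subseteq> VT" using gh ends(4,5) T(2-4) by auto
  then have "C - {e} \<subseteq> ET" using subtree_contains_rest_of_cycle[OF T(1)] e(2) by blast
  then show ?thesis using proper_tree_subset[OF T(5)] \<open>e \<in> C\<close> by blast
qed

lemma proper_tree_delete_cycle_edge: "\<exists>e\<in>C. proper_tree c (E - {e})"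
proof -
  consider (bridge) g h where "color_clash c g h" "g \<in> E - C" "h \<in> C"
    | (cycle) g h where "color_clash c g h" "g \<in> C" "h \<in> C"
        "\<And>p q. p \<in> E \<Longrightarrow> q \<in> E \<Longrightarrow> color_clash c p q \<Longrightarrow> p \<in> C \<and> q \<in> C"
    | (none) "proper_tree c E"
    using color_clash_meets_cycle color_clash_sym unfolding proper_tree_iff_no_clash
    by (metis DiffI)
  then show ?thesis
  proof cases
    case bridge
    then have "p = h \<or> q = h" if "p \<in> E" "q \<in> E" "color_clash c p q" for p q
      using that bridge_cycle_clash_edge_in_clash color_clash_meets_cycle color_clash_sym by metis
    then show ?thesis using bridge(3) unfolding proper_tree_iff_no_clash by blast
  next
    case cycle
    obtain e where e: "e \<in> C" "proper_tree c (C - {e})"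
      using proper_cycle_delete_edge[OF cycle(1-3)] by blast
    have "proper_tree c (E - {e})"
      using e(2) cycle(4) unfolding proper_tree_iff_no_clash by blast
    then show ?thesis using e(1) by blast
  next
    case none
    then show ?thesis using cycle_nonempty proper_tree_subset[OF none] by blast
  qed
qed

end

theorem proper_index_eq_Min_max_degree:
  assumes k: "3 \<le> k" "k \<le> card V"
  shows "proper_index V E k = (MIN e\<in>C. max_degree V (E - {e}))"
proof -
  let ?d = "\<lambda>e. max_degree V (E - {e})"
  have "(MIN e\<in>C. ?d e) \<in> ?d ` C" using finite_cycle cycle_nonempty by (intro Min_in) auto
  then obtain e where e: "e \<in> C" "(MIN e\<in>C. ?d e) = ?d e" by blast
  obtain u v where uv: "u \<in> V" "v \<in> V" "u \<noteq> v" using cycle_edgeE[OF e(1)] by metis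
  have T: "is_subtree V E V (E - {e})" using spanning_tree_delete_cycle_edge[OF e(1)] .
  then have "0 < degree (E - {e}) u"
    using connected_graph_degree_pos[OF _ _ uv] finite_E by (simp add: is_subtree_def)
  then have "0 < ?d e" using degree_le_max_degree[OF finite_V uv(1), of "E - {e}"] by simp
  then obtain c where c: "k_proper_coloring V E k c" "card (c ` E) \<le> ?d e"
    using spanning_tree_k_proper_coloring[OF simple T] by blast
  have "(MIN e\<in>C. ?d e) \<le> card (c' ` E)" if c': "k_proper_coloring V E k c'" for c'
  proof -
    obtain f where f: "f \<in> C" "proper_tree c' (E - {f})"
      using proper_tree_delete_cycle_edge[OF c' k] by blast
    have "(MIN e\<in>C. ?d e) \<le> ?d f" using f(1) finite_cycle by simp
    also have "\<dots> \<le> card (c' ` (E - {f}))"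
      using proper_tree_degree_le_card_colors[OF f(2)] finite_V finite_E uv(1)
      unfolding max_degree_def by (subst Max_le_iff) auto
    also have "\<dots> \<le> card (c' ` E)" using finite_E by (intro card_mono) auto
    finally show ?thesis .
  qed
  then show ?thesis using proper_index_eqI[OF c(1)] c(2) e(2) by simp
qed

lemma Min_max_degree_delete_cycle_edge:
  "(MIN e\<in>C. max_degree V (E - {e})) =
    (if \<exists>e\<in>C. max_degree_vertices V E \<subseteq> e then max_degree V E - 1 else max_degree V E)"
proof -
  have "max_degree V (E - {e}) =
      (if max_degree_vertices V E \<subseteq> e then max_degree V E - 1 else max_degree V E)" if "e \<in> C" for e
    using max_degree_delete_edge[OF simple] that cycle_subset by blast
  then have "(\<lambda>e. max_degree V (E - {e})) ` C =
      (\<lambda>e. if max_degree_vertices V E \<subseteq> e then max_degree V E - 1 else max_degree V E) ` C"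
    by (intro image_cong) auto
  then show ?thesis using finite_cycle cycle_nonempty by (simp only:) (intro Min_eqI; auto)
qed

end

theorem mainTheorem13:
  fixes V :: "'a set" and E :: "'a set set" and k :: nat
  assumes "simple_graph V E"
    and "unicyclic V E"
    and "card V \<ge> 3"
    and "3 \<le> k" and "k \<le> card V"
  shows "proper_index V E k =
    (if card {v \<in> V. degree E v = max_degree V E} \<le> 2
        \<and> (\<forall>v\<in>V. degree E v = max_degree V E \<longrightarrow> (\<forall>C. is_cycle_in E C \<longrightarrow> v \<in> \<Union>C))
        \<and> (\<forall>u\<in>V. \<forall>v\<in>V. degree E u = max_degree V E \<and> degree E v = max_degree V E \<and> u \<noteq> v
              \<longrightarrow> {u, v} \<in> E)
     then max_degree V E - 1 else max_degree V E)"
    (is "_ = (if ?conditions then _ else _)")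
proof -
  obtain C where C: "\<And>C'. is_cycle_in E C' \<longleftrightarrow> C' = C"
    using assms(2) unfolding unicyclic_def by metis
  interpret unicyclic_graph V E C
  proof
    show "connected_graph V E" using assms(2) by (simp add: unicyclic_def)
  qed (fact assms(1) C)+
  have "?conditions \<longleftrightarrow> (\<exists>e\<in>C. max_degree_vertices V E \<subseteq> e)"
    unfolding max_degree_vertices_subset_cycle_edge_iff
    unfolding max_degree_vertices_def cycle_iff by blast
  then show ?thesis
    using proper_index_eq_Min_max_degree[OF assms(4,5)] Min_max_degree_delete_cycle_edge
    by (simp only:)
qed

end
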